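(* Let $q=p^m>4$ be a prime power ($p$ prime) and let $0\le e\le m-1$. If there exists an $[n,k]_q$ GRS code with $l$-dimensional $e$-Galois hull, where $0\le l\le k$, then for any $1\le i\le\min\{l,n-k\}$ and each $0\le s\le l-i$ there exists an $[n,k+i]_q$ MDS code with $s$-dimensional $e$-Galois hull.
   Context: For $\bm x,\bm y\in\mathbb F_q^n$, the $e$-Galois inner product is $\langle\bm x,\bm y\rangle_e=\sum_{i=1}^n x_iy_i^{p^e}$. For a linear code $\mathcal C\subseteq\mathbb F_q^n$, $\mathcal C^{\perp_e}=\{\bm x\in\mathbb F_q^n:\langle\bm y,\bm x\rangle_e=0\ \text{for all }\bm y\in\mathcal C\}$ and the $e$-Galois hull is $\mathrm{Hull}_e(\mathcal C)=\mathcal C\cap\mathcal C^{\perp_e}$. An $[n,k]_q$ GRS code ($1\le k\le n$) is a code $\{(v_1f(a_1),\dots,v_nf(a_n)):f\in\mathbb F_q[x],\deg f\le k-1\}$ with distinct $a_j\in\mathbb F_q$ and $v_j\in\mathbb F_q^*$. An $[n,k]$ code is MDS if its minimum distance is $n-k+1$. *)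

theory Defs
  imports
    "HOL-Analysis.Cartesian_Space"
    "HOL-Computational_Algebra.Polynomial"
    "HOL-Computational_Algebra.Primes"
begin

text \<open>
  Codes are subsets of \<open>'a ^ 'n\<close>, where \<open>'a\<close> is a finite field with \<open>q = p ^ m\<close> elements and
  the coordinates are indexed by a finite type \<open>'n\<close>, so that the length is \<open>CARD('n)\<close>.
  The parameter \<open>p\<close> below is meant to be the characteristic of \<open>'a\<close>.
\<close>

definition galois_inner :: "nat \<Rightarrow> nat \<Rightarrow> 'a::field ^ 'n \<Rightarrow> 'a ^ 'n \<Rightarrow> 'a" where
  "galois_inner p e x y = (\<Sum>i\<in>UNIV. x $ i * (y $ i) ^ (p ^ e))"

definition galois_dual :: "nat \<Rightarrow> nat \<Rightarrow> ('a::field ^ 'n) set \<Rightarrow> ('a ^ 'n) set" where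
  "galois_dual p e C = {x. \<forall>y\<in>C. galois_inner p e y x = 0}"

definition galois_hull :: "nat \<Rightarrow> nat \<Rightarrow> ('a::field ^ 'n) set \<Rightarrow> ('a ^ 'n) set" where
  "galois_hull p e C = C \<inter> galois_dual p e C"

definition linear_code :: "nat \<Rightarrow> ('a::field ^ 'n) set \<Rightarrow> bool" where
  "linear_code k C \<longleftrightarrow> vec.subspace C \<and> vec.dim C = k"

definition hamming_dist :: "'a ^ 'n \<Rightarrow> 'a ^ 'n \<Rightarrow> nat" where
  "hamming_dist x y = card {i. x $ i \<noteq> y $ i}"

text \<open>Only meaningful for codes with at least two codewords.\<close>

definition min_dist :: "('a ^ 'n) set \<Rightarrow> nat" where
  "min_dist C = Min {hamming_dist x y |x y. x \<in> C \<and> y \<in> C \<and> x \<noteq> y}"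

definition MDS_code :: "nat \<Rightarrow> ('a::field ^ 'n) set \<Rightarrow> bool" where
  "MDS_code k C \<longleftrightarrow> linear_code k C \<and> min_dist C = CARD('n) - k + 1"

text \<open>
  Since \<open>degree 0 = 0\<close> and \<open>k \<ge> 1\<close>, the condition \<open>degree f \<le> k - 1\<close> includes the zero polynomial.
\<close>

definition GRS_code :: "nat \<Rightarrow> ('a::field ^ 'n) set \<Rightarrow> bool" where
  "GRS_code k C \<longleftrightarrow> 1 \<le> k \<and> k \<le> CARD('n) \<and>
     (\<exists>a v :: 'a ^ 'n. inj (($) a) \<and> (\<forall>j. v $ j \<noteq> 0) \<and>
        C = {(\<chi> j. v $ j * poly f (a $ j)) |f. degree f \<le> k - 1})"

end

theory Submission
  imports Defs
begin

text \<open>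
  Enlarging the dimension of a GRS code by one costs at most one dimension of the hull, because the
  old hull only has to be cut by one further orthogonality condition. So the GRS code of dimension
  \<open>k + i\<close> with the same evaluation points and multipliers has a hull of dimension at least
  \<open>l - i\<close>, and it remains to lower the hull dimension of this code to any smaller value.

  Rescaling coordinate \<open>j\<close> of a code by \<open>u\<^sub>j\<close> replaces the Galois inner product by the weighted form
  with weights \<open>u\<^sub>j ^ (p\<^sup>e + 1)\<close>. Since \<open>q > 4\<close>, some nonzero \<open>\<alpha>\<close> has \<open>\<beta> = \<alpha> ^ (p\<^sup>e + 1) \<noteq> 1\<close>.
  Changing one weight changes the dimension of the radical by at most one, so all values between
  the hull dimension (all weights 1) and 0 occur once some weights in \<open>{1, \<beta>}\<close> make the form
  nondegenerate. To find them, start from the indicator function of an information set, which is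
  nondegenerate, and change the weights one by one: at each coordinate at most one weight makes a
  nondegenerate form degenerate.
\<close>

section \<open>Semilinear functionals and weighted forms\<close>

definition weighted_form :: "('a::field \<Rightarrow> 'a) \<Rightarrow> ('n \<Rightarrow> 'a) \<Rightarrow> 'a ^ 'n \<Rightarrow> 'a ^ 'n::finite \<Rightarrow> 'a" where
  "weighted_form \<sigma> w y x = (\<Sum>j\<in>UNIV. w j * (y $ j * \<sigma> (x $ j)))"

text \<open>The form is linear in its first argument and, for a field automorphism, semilinear in
  its second. The radical lives in the second slot, where the Galois dual puts its vectors.\<close>

definition radical :: "('a::field \<Rightarrow> 'a) \<Rightarrow> ('n \<Rightarrow> 'a) \<Rightarrow> ('a ^ 'n::finite) set \<Rightarrow> ('a ^ 'n) set" where
  "radical \<sigma> w C = {x \<in> C. \<forall>y\<in>C. weighted_form \<sigma> w y x = 0}"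

lemma radical_subset: "radical \<sigma> w C \<subseteq> C"
  by (auto simp: radical_def)

lemma weighted_form_add_left:
  "weighted_form \<sigma> w (y + z) x = weighted_form \<sigma> w y x + weighted_form \<sigma> w z x"
  by (simp add: weighted_form_def algebra_simps sum.distrib)

lemma weighted_form_scale_left:
  "weighted_form \<sigma> w (c *s y) x = c * weighted_form \<sigma> w y x"
  by (simp add: weighted_form_def algebra_simps sum_distrib_left)

lemma weighted_form_upd:
  "weighted_form \<sigma> (w(j := t)) y x = weighted_form \<sigma> w y x + (t - w j) * (y $ j * \<sigma> (x $ j))"
proof -
  have "weighted_form \<sigma> (w(j := t)) y x
      = t * (y $ j * \<sigma> (x $ j)) + (\<Sum>i\<in>UNIV - {j}. w i * (y $ i * \<sigma> (x $ i)))"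
    unfolding weighted_form_def by (subst sum.remove[of _ j]) auto
  moreover have "weighted_form \<sigma> w y x
      = w j * (y $ j * \<sigma> (x $ j)) + (\<Sum>i\<in>UNIV - {j}. w i * (y $ i * \<sigma> (x $ i)))"
    unfolding weighted_form_def by (subst sum.remove[of _ j]) auto
  ultimately show ?thesis by (simp add: algebra_simps)
qed

locale field_automorphism =
  fixes \<sigma> :: "'a::field \<Rightarrow> 'a"
  assumes add: "\<sigma> (x + y) = \<sigma> x + \<sigma> y"
    and mult: "\<sigma> (x * y) = \<sigma> x * \<sigma> y"
    and bij: "bij \<sigma>"
begin

lemma zero [simp]: "\<sigma> 0 = 0"
  using add[of 0 0] by (metis add_0 add_left_cancel add.right_neutral)

lemma eq_0_iff [simp]: "\<sigma> x = 0 \<longleftrightarrow> x = 0"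
  using bij zero by (metis bij_pointE)

lemma obtain_preimage: obtains c where "\<sigma> c = d"
  using bij by (metis bij_pointE)

lemma weighted_form_add_right:
  "weighted_form \<sigma> w y (x + z) = weighted_form \<sigma> w y x + weighted_form \<sigma> w y z"
  by (simp add: weighted_form_def algebra_simps sum.distrib add)

lemma weighted_form_scale_right:
  "weighted_form \<sigma> w y (c *s x) = \<sigma> c * weighted_form \<sigma> w y x"
  by (simp add: weighted_form_def algebra_simps sum_distrib_left mult)

lemma weighted_form_zero_right: "weighted_form \<sigma> w y 0 = 0"
  by (simp add: weighted_form_def)

lemma subspace_radical:
  assumes "vec.subspace C"
  shows "vec.subspace (radical \<sigma> w C)"
  using assms
  by (auto simp: radical_def vec.subspace_def weighted_form_add_right weighted_form_scale_right
      weighted_form_zero_right)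

text \<open>Once \<open>f h \<noteq> 0\<close>, adding a suitable multiple of \<open>h\<close> moves
  any vector of \<open>H\<close> into the kernel; surjectivity of \<open>\<sigma>\<close> supplies
  the scalar despite semilinearity.\<close>

lemma dim_le_Suc_dim_kernel:
  fixes H :: "('a ^ 'n::finite) set"
  assumes H: "vec.subspace H"
    and f_add: "\<And>x y. f (x + y) = f x + f y"
    and f_scale: "\<And>c x. f (c *s x) = \<sigma> c * f x"
  shows "vec.dim H \<le> vec.dim {x \<in> H. f x = 0} + 1"
proof (cases "\<exists>h\<in>H. f h \<noteq> 0")
  case False
  then have "{x \<in> H. f x = 0} = H" by auto
  then show ?thesis by simp
next
  case True
  then obtain h where h: "h \<in> H" "f h \<noteq> 0" by auto
  let ?K = "{x \<in> H. f x = 0}"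
  have "H \<subseteq> vec.span (insert h ?K)"
  proof
    fix x assume x: "x \<in> H"
    obtain c where c: "\<sigma> c = - (f x / f h)" by (rule obtain_preimage)
    have "f (x + c *s h) = 0"
      using h by (simp add: f_add f_scale c)
    then have "x + c *s h \<in> ?K"
      using H x h by (simp add: vec.subspace_add vec.subspace_scale)
    moreover have "x = (x + c *s h) - c *s h" by simp
    ultimately show "x \<in> vec.span (insert h ?K)"
      by (metis (no_types, lifting) insertI1 insertI2 vec.span_base vec.span_diff vec.span_scale)
  qed
  then have "vec.dim H \<le> vec.dim (insert h ?K)" by (rule vec.dim_mono)
  also have "\<dots> \<le> vec.dim ?K + 1" by (simp add: vec.dim_insert)
  finally show ?thesis .
qed

text \<open>A vector of the old radical that is also annihilated by \<open>u\<close> is annihilated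
  by the whole span, and annihilation by \<open>u\<close> is a single semilinear condition.\<close>

lemma dim_radical_extend:
  fixes C :: "('a ^ 'n::finite) set"
  assumes C: "vec.subspace C"
  shows "vec.dim (radical \<sigma> w C) \<le> vec.dim (radical \<sigma> w (vec.span (insert u C))) + 1"
proof -
  have "vec.dim (radical \<sigma> w C) \<le> vec.dim {x \<in> radical \<sigma> w C. weighted_form \<sigma> w u x = 0} + 1"
    by (intro dim_le_Suc_dim_kernel subspace_radical C weighted_form_add_right
        weighted_form_scale_right)
  also have "{x \<in> radical \<sigma> w C. weighted_form \<sigma> w u x = 0}
      \<subseteq> radical \<sigma> w (vec.span (insert u C))" (is "?L \<subseteq> ?R")
  proof
    fix x assume x: "x \<in> ?L"
    have "weighted_form \<sigma> w (c *s u + z) x = 0" if "z \<in> C" for c z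
      using x that by (simp add: weighted_form_add_left weighted_form_scale_left radical_def)
    moreover have "\<exists>c. \<exists>z\<in>C. y = c *s u + z" if y: "y \<in> vec.span (insert u C)" for y
    proof -
      obtain c where "y - c *s u \<in> vec.span C"
        using vec.span_breakdown_eq[THEN iffD1, OF y] by (elim exE)
      then have "y - c *s u \<in> C" using C by (simp add: vec.span_eq_iff[THEN iffD2])
      then show ?thesis by (metis add.commute diff_add_cancel)
    qed
    ultimately show "x \<in> ?R"
      using x vec.span_superset[of "insert u C"] by (fastforce simp: radical_def)
  qed
  then have "vec.dim ?L + 1 \<le> vec.dim ?R + 1" by (simp add: vec.dim_subset)
  finally show ?thesis .
qed

text \<open>Vectors with zero \<open>j\<close>-th coordinate do not see the weight there; within the
  radical they form a subspace of codimension at most one.\<close>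

lemma dim_radical_upd:
  fixes C :: "('a ^ 'n::finite) set"
  assumes C: "vec.subspace C"
  shows "vec.dim (radical \<sigma> w C) \<le> vec.dim (radical \<sigma> (w(j := t)) C) + 1"
proof -
  have "vec.dim (radical \<sigma> w C) \<le> vec.dim {x \<in> radical \<sigma> w C. \<sigma> (x $ j) = 0} + 1"
    by (intro dim_le_Suc_dim_kernel subspace_radical C) (simp_all add: add mult)
  also have "{x \<in> radical \<sigma> w C. \<sigma> (x $ j) = 0} \<subseteq> radical \<sigma> (w(j := t)) C"
    by (auto simp: radical_def weighted_form_upd)
  then have "vec.dim {x \<in> radical \<sigma> w C. \<sigma> (x $ j) = 0} + 1
      \<le> vec.dim (radical \<sigma> (w(j := t)) C) + 1"
    by (simp add: vec.dim_subset)
  finally show ?thesis .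
qed

text \<open>
  Nonzero elements \<open>x1\<close>, \<open>x2\<close> of the two updated radicals can be normalised to have \<open>j\<close>-th coordinate
  1. Both represent a multiple of the \<open>j\<close>-th coordinate functional with respect to the original
  form, so they are proportional, hence equal, and then \<open>t1 = t2\<close>.
\<close>

lemma nondegenerate_upd:
  fixes C :: "('a ^ 'n::finite) set"
  assumes C: "vec.subspace C"
    and nondeg: "radical \<sigma> w C \<subseteq> {0}" and "t1 \<noteq> t2"
  shows "\<exists>t\<in>{t1, t2}. radical \<sigma> (w(j := t)) C \<subseteq> {0}"
proof (rule ccontr)
  assume contr: "\<not> ?thesis"
  have witness: "\<exists>x\<in>C. x $ j = 1 \<and> (\<forall>y\<in>C. weighted_form \<sigma> w y x = (w j - t) * y $ j)"
    if t: "\<not> radical \<sigma> (w(j := t)) C \<subseteq> {0}" for t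
  proof -
    let ?R = "radical \<sigma> (w(j := t)) C"
    obtain z where z: "z \<in> ?R" "z \<noteq> 0" using t by auto
    have "z $ j \<noteq> 0"
    proof
      assume "z $ j = 0"
      then have "z \<in> radical \<sigma> w C"
        using z(1) by (auto simp: radical_def weighted_form_upd)
      with nondeg z(2) show False by auto
    qed
    then obtain x where x: "x \<in> ?R" "x $ j = 1"
      using z(1) subspace_radical[OF C, of "w(j := t)"]
      by (intro that[of "inverse (z $ j) *s z"]) (simp_all add: vec.subspace_scale)
    have "\<sigma> 1 = 1" using mult[of 1 1] eq_0_iff[of 1] by simp
    then have "\<forall>y\<in>C. weighted_form \<sigma> w y x = (w j - t) * y $ j"
      using x by (auto simp: radical_def weighted_form_upd algebra_simps eq_neg_iff_add_eq_0)
    with x show ?thesis using radical_subset by blast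
  qed
  obtain x1 where x1: "x1 \<in> C" "x1 $ j = 1"
    "\<And>y. y \<in> C \<Longrightarrow> weighted_form \<sigma> w y x1 = (w j - t1) * y $ j"
    using witness[of t1] contr by auto
  obtain x2 where x2: "x2 \<in> C" "x2 $ j = 1"
    "\<And>y. y \<in> C \<Longrightarrow> weighted_form \<sigma> w y x2 = (w j - t2) * y $ j"
    using witness[of t2] contr by auto
  \<comment> \<open>The scalars are chosen so that, against every \<open>y\<close>, the
    contributions \<open>(t2 - w j) * (w j - t1)\<close> and \<open>(w j - t1) * (w j - t2)\<close>
    cancel.\<close>
  obtain c1 where c1: "\<sigma> c1 = w j - t1" by (rule obtain_preimage)
  obtain c2 where c2: "\<sigma> c2 = t2 - w j" by (rule obtain_preimage)
  have "weighted_form \<sigma> w y (c2 *s x1 + c1 *s x2) = 0" if "y \<in> C" for y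
    unfolding weighted_form_add_right weighted_form_scale_right c1 c2 x1(3)[OF that] x2(3)[OF that]
    by (simp add: algebra_simps)
  then have "c2 *s x1 + c1 *s x2 \<in> radical \<sigma> w C"
    using C x1(1) x2(1) by (simp add: radical_def vec.subspace_add vec.subspace_scale)
  then have "c2 *s x1 + c1 *s x2 = 0" using nondeg by auto
  then have "(c2 *s x1 + c1 *s x2) $ j = 0" by simp
  then have "c2 + c1 = 0" using x1 x2 by simp
  then have "\<sigma> c2 + \<sigma> c1 = 0" by (metis add zero)
  with \<open>t1 \<noteq> t2\<close> show False by (simp add: c1 c2)
qed

text \<open>The induction runs over the coordinates already treated. Weights outside
  \<open>S\<close> are unconstrained, so \<open>w0\<close> may take values other than
  \<open>t1\<close> and \<open>t2\<close>, such as 0.\<close>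

lemma nondegenerate_two_weights:
  fixes C :: "('a ^ 'n::finite) set"
  assumes C: "vec.subspace C"
    and nondeg: "radical \<sigma> w0 C \<subseteq> {0}" and "t1 \<noteq> t2"
  shows "\<exists>A. radical \<sigma> (\<lambda>j. if j \<in> A then t2 else t1) C \<subseteq> {0}"
proof -
  have "\<exists>w. (\<forall>j\<in>S. w j \<in> {t1, t2}) \<and> radical \<sigma> w C \<subseteq> {0}" if "finite S" for S
    using that
  proof induction
    case empty
    then show ?case using nondeg by auto
  next
    case (insert j S)
    then obtain w where w: "\<forall>i\<in>S. w i \<in> {t1, t2}" "radical \<sigma> w C \<subseteq> {0}" by auto
    obtain t where "t \<in> {t1, t2}" "radical \<sigma> (w(j := t)) C \<subseteq> {0}"
      using nondegenerate_upd[OF C w(2) \<open>t1 \<noteq> t2\<close>] by blast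
    moreover from w(1) have "\<forall>i\<in>insert j S. (w(j := t)) i \<in> {t1, t2}"
      using \<open>t \<in> {t1, t2}\<close> by simp
    ultimately show ?case by blast
  qed
  from this[of UNIV] obtain w where w: "\<forall>j. w j \<in> {t1, t2}" "radical \<sigma> w C \<subseteq> {0}" by auto
  have "(\<lambda>j. if j \<in> {j. w j = t2} then t2 else t1) = w"
    using w(1) by (auto simp: fun_eq_iff)
  with w(2) show ?thesis by (intro exI[of _ "{j. w j = t2}"]) simp
qed

end

section \<open>Attaining every smaller radical dimension\<close>

lemma discrete_IVT_set:
  fixes f :: "'b set \<Rightarrow> nat"
  assumes "finite T" and "s \<le> f {}" and "f T \<le> s" and "\<And>x A. f A \<le> f (insert x A) + 1"
  shows "\<exists>A. f A = s"
  using assms(1,3)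
proof induction
  case empty
  with assms(2) show ?case by (metis le_antisym)
next
  case (insert x T)
  show ?case
  proof (cases "f T \<le> s")
    case True
    then show ?thesis by (rule insert.IH)
  next
    \<comment> \<open>This insertion takes \<open>f\<close> from above \<open>s\<close> to at most
      \<open>s\<close>. Since a single insertion lowers \<open>f\<close> by at most one, it lands
      exactly on \<open>s\<close>.\<close>
    case False
    with insert.prems assms(4)[of T x] have "f (insert x T) = s" by linarith
    then show ?thesis ..
  qed
qed

lemma (in field_automorphism) radical_dim_two_weights:
  fixes C :: "('a ^ 'n::finite) set"
  assumes C: "vec.subspace C"
    and nondeg: "radical \<sigma> w0 C \<subseteq> {0}" and "t1 \<noteq> t2"
    and s: "s \<le> vec.dim (radical \<sigma> (\<lambda>_. t1) C)"
  shows "\<exists>A. vec.dim (radical \<sigma> (\<lambda>j. if j \<in> A then t2 else t1) C) = s"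
proof -
  define f where "f A = vec.dim (radical \<sigma> (\<lambda>j. if j \<in> A then t2 else t1) C)" for A
  obtain T where "radical \<sigma> (\<lambda>j. if j \<in> T then t2 else t1) C \<subseteq> {0}"
    using nondegenerate_two_weights[OF C nondeg \<open>t1 \<noteq> t2\<close>] by blast
  then have "f T = 0" unfolding f_def by simp
  moreover have "f A \<le> f (insert x A) + 1" for x A
  proof -
    have "(\<lambda>j. if j \<in> A then t2 else t1)(x := t2) = (\<lambda>j. if j \<in> insert x A then t2 else t1)"
      by auto
    then show ?thesis unfolding f_def using dim_radical_upd[OF C] by metis
  qed
  moreover have "s \<le> f {}" using s by (simp add: f_def)
  ultimately have "\<exists>A. f A = s"
    by (intro discrete_IVT_set[of T]) simp_all
  then show ?thesis by (simp add: f_def)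
qed

section \<open>Rescaling of coordinates\<close>

lemma galois_hull_eq_radical:
  "galois_hull p e C = radical (\<lambda>x. x ^ (p ^ e)) (\<lambda>_. 1) C"
  by (auto simp: galois_hull_def galois_dual_def radical_def galois_inner_def weighted_form_def)

lemma dim_galois_hull_rescale:
  fixes C :: "('a::field ^ 'n::finite) set" and u :: "'n \<Rightarrow> 'a"
  assumes "\<And>j. u j \<noteq> 0"
  shows "vec.dim (galois_hull p e ((\<lambda>x. \<chi> j. u j * x $ j) ` C))
       = vec.dim (radical (\<lambda>x. x ^ (p ^ e)) (\<lambda>j. u j ^ (p ^ e + 1)) C)"
proof -
  let ?\<sigma> = "\<lambda>x::'a. x ^ (p ^ e)" and ?T = "\<lambda>x::'a ^ 'n. \<chi> j. u j * x $ j"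
  \<comment> \<open>The first argument contributes a factor \<open>u j\<close>, the second a factor
    \<open>u j ^ (p ^ e)\<close>.\<close>
  have "weighted_form ?\<sigma> (\<lambda>_. 1) (?T y) (?T x) = weighted_form ?\<sigma> (\<lambda>j. u j ^ (p ^ e + 1)) y x" for x y
    by (simp add: weighted_form_def power_mult_distrib mult_ac)
  then have hull: "galois_hull p e (?T ` C) = ?T ` radical ?\<sigma> (\<lambda>j. u j ^ (p ^ e + 1)) C"
    unfolding galois_hull_eq_radical by (auto simp: radical_def)
  have "Vector_Spaces.linear (*s) (*s) ?T"
    by unfold_locales (auto simp: vec_eq_iff algebra_simps)
  moreover have "inj ?T"
    using assms by (auto simp: inj_def vec_eq_iff)
  ultimately show ?thesis
    unfolding hull by (intro vec.dim_image_eq) (auto intro: inj_on_subset)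
qed

section \<open>Generalized Reed-Solomon codes\<close>

text \<open>Unlike \<^term>\<open>degree f \<le> k - 1\<close>, the condition on the coefficients makes sense for \<open>k = 0\<close>.\<close>

definition grs :: "'a ^ 'n \<Rightarrow> 'a ^ 'n \<Rightarrow> nat \<Rightarrow> ('a::field ^ 'n::finite) set" where
  "grs a v k = {(\<chi> j. v $ j * poly f (a $ j)) |f. \<forall>i\<ge>k. coeff f i = 0}"

lemma GRS_code_iff_grs:
  fixes C :: "('a::field ^ 'n::finite) set"
  shows "GRS_code k C \<longleftrightarrow> 1 \<le> k \<and> k \<le> CARD('n) \<and>
    (\<exists>a v. inj (($) a) \<and> (\<forall>j. v $ j \<noteq> 0) \<and> C = grs a v k)"
proof -
  have "(\<forall>i\<ge>k. coeff f i = 0) \<longleftrightarrow> degree f \<le> k - 1" if "1 \<le> k" for f :: "'a poly"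
  proof
    assume "\<forall>i\<ge>k. coeff f i = 0"
    then show "degree f \<le> k - 1" using that by (intro degree_le) auto
  next
    assume "degree f \<le> k - 1"
    then have "degree f < k" using that by simp
    then show "\<forall>i\<ge>k. coeff f i = 0" by (auto intro: coeff_eq_0)
  qed
  then show ?thesis unfolding GRS_code_def grs_def by (auto cong: conj_cong)
qed

lemma subspace_grs: "vec.subspace (grs a v k)"
proof (rule vec.subspaceI)
  show "0 \<in> grs a v k"
    unfolding grs_def by (auto simp: vec_eq_iff intro!: exI[of _ 0])
next
  fix x y assume "x \<in> grs a v k" "y \<in> grs a v k"
  then obtain f g where "x = (\<chi> j. v $ j * poly f (a $ j))" "\<forall>i\<ge>k. coeff f i = 0"
    "y = (\<chi> j. v $ j * poly g (a $ j))" "\<forall>i\<ge>k. coeff g i = 0"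
    unfolding grs_def by auto
  then show "x + y \<in> grs a v k"
    unfolding grs_def by (auto simp: vec_eq_iff algebra_simps intro!: exI[of _ "f + g"])
next
  fix c x assume "x \<in> grs a v k"
  then obtain f where "x = (\<chi> j. v $ j * poly f (a $ j))" "\<forall>i\<ge>k. coeff f i = 0"
    unfolding grs_def by auto
  then show "c *s x \<in> grs a v k"
    unfolding grs_def by (auto simp: vec_eq_iff algebra_simps intro!: exI[of _ "smult c f"])
qed

lemma grs_0: "grs a v 0 = {0}"
proof -
  have "(\<forall>i. coeff f i = 0) \<longleftrightarrow> f = 0" for f :: "'a poly"
    by (simp add: poly_eq_iff)
  then show ?thesis by (auto simp: grs_def vec_eq_iff)
qed

lemma grs_mono: "k \<le> k' \<Longrightarrow> grs a v k \<subseteq> grs a v k'"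
  unfolding grs_def by fastforce

text \<open>Splitting off the monomial of degree \<open>k\<close> exhibits one new generator, so
  statements about the dimension can be proved by induction on \<open>k\<close>.\<close>

lemma grs_Suc: "grs a v (Suc k) = vec.span (insert (\<chi> j. v $ j * (a $ j) ^ k) (grs a v k))"
proof
  let ?u = "\<chi> j. v $ j * (a $ j) ^ k"
  show "grs a v (Suc k) \<subseteq> vec.span (insert ?u (grs a v k))"
  proof
    fix x assume "x \<in> grs a v (Suc k)"
    then obtain f where x: "x = (\<chi> j. v $ j * poly f (a $ j))" and f: "\<forall>i\<ge>Suc k. coeff f i = 0"
      unfolding grs_def by auto
    define g where "g = f - monom (coeff f k) k"
    have "\<forall>i\<ge>k. coeff g i = 0"
      using f by (simp add: g_def Suc_le_eq)
    then have "(\<chi> j. v $ j * poly g (a $ j)) \<in> grs a v k" unfolding grs_def by auto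
    moreover have "x = coeff f k *s ?u + (\<chi> j. v $ j * poly g (a $ j))"
      by (simp add: x g_def vec_eq_iff poly_monom algebra_simps)
    ultimately show "x \<in> vec.span (insert ?u (grs a v k))"
      by (metis (no_types, lifting) insertI1 insertI2 vec.span_add vec.span_base vec.span_scale)
  qed
  have "?u \<in> grs a v (Suc k)"
    unfolding grs_def by (auto simp: poly_monom intro!: exI[of _ "monom 1 k"])
  then show "vec.span (insert ?u (grs a v k)) \<subseteq> grs a v (Suc k)"
    using grs_mono[of k "Suc k" a v] by (intro vec.span_minimal subspace_grs) auto
qed

lemma card_zeros_le:
  fixes a :: "'a::field ^ 'n::finite"
  assumes "inj (($) a)" and "f \<noteq> 0"
  shows "card {j. poly f (a $ j) = 0} \<le> degree f"
proof -
  have "card {j. poly f (a $ j) = 0} = card (($) a ` {j. poly f (a $ j) = 0})"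
    using assms(1) by (metis card_image inj_on_subset subset_UNIV)
  also have "\<dots> \<le> card {x. poly f x = 0}"
    using poly_roots_finite[OF assms(2)] by (intro card_mono) auto
  also have "\<dots> \<le> degree f" by (rule card_poly_roots_bound[OF assms(2)])
  finally show ?thesis .
qed

lemma degree_less_if_coeff_0:
  assumes "\<forall>i\<ge>k. coeff f i = 0" and "f \<noteq> 0"
  shows "degree f < k"
  using assms by (metis leading_coeff_0_iff not_le)

lemma dim_grs:
  fixes a v :: "'a::field ^ 'n::finite"
  assumes a: "inj (($) a)" and v: "\<And>j. v $ j \<noteq> 0" and "k \<le> CARD('n)"
  shows "vec.dim (grs a v k) = k"
  using \<open>k \<le> CARD('n)\<close>
proof (induction k)
  case 0
  show ?case by (simp add: grs_0)
next
  case (Suc k)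
  let ?u = "\<chi> j. v $ j * (a $ j) ^ k"
  have "?u \<notin> grs a v k"
  proof
    assume "?u \<in> grs a v k"
    then obtain f where f: "?u = (\<chi> j. v $ j * poly f (a $ j))" "\<forall>i\<ge>k. coeff f i = 0"
      unfolding grs_def by auto
    \<comment> \<open>If the new generator were already in the code, \<open>g\<close> would be
      nonzero of degree at most \<open>k\<close> and vanish at all evaluation points, more than
      \<open>k\<close> in number.\<close>
    define g where "g = monom 1 k - f"
    have "coeff g k \<noteq> 0" using f(2) by (simp add: g_def)
    then have "g \<noteq> 0" by auto
    have "\<forall>i\<ge>Suc k. coeff g i = 0" using f(2) by (simp add: g_def)
    then have "degree g < Suc k" using \<open>g \<noteq> 0\<close> by (rule degree_less_if_coeff_0)
    moreover have "poly g (a $ j) = 0" for j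
      using f(1) v by (simp add: g_def poly_monom vec_eq_iff)
    then have "CARD('n) \<le> degree g"
      using card_zeros_le[OF a \<open>g \<noteq> 0\<close>] by simp
    ultimately show False using Suc.prems by simp
  qed
  then have "?u \<notin> vec.span (grs a v k)"
    using subspace_grs by (metis vec.span_eq_iff)
  then show ?case
    using Suc by (simp add: grs_Suc vec.dim_insert)
qed

text \<open>Provides both a codeword of minimum weight and, on an information set, codewords that
  vanish at all but one of its coordinates.\<close>

lemma poly_vanishing_on:
  fixes a :: "'a::field ^ 'n::finite"
  assumes "inj (($) a)"
  shows "\<exists>f. degree f = card J \<and> (\<forall>j. poly f (a $ j) = 0 \<longleftrightarrow> j \<in> J)"
proof (intro exI conjI allI)
  let ?f = "\<Prod>j\<in>J. [:- (a $ j), 1:]"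
  show "degree ?f = card J" by (simp add: degree_prod_eq_sum_degree)
  show "poly ?f (a $ j) = 0 \<longleftrightarrow> j \<in> J" for j
    using assms by (auto simp: poly_prod inj_def)
qed

text \<open>By linearity, a distance counts the evaluation points where one nonzero polynomial of
  degree below \<open>k\<close> does not vanish. At most \<open>k - 1\<close> points are zeros, and
  a product of \<open>k - 1\<close> linear factors attains this.\<close>

lemma MDS_code_grs:
  fixes a v :: "'a::field ^ 'n::finite"
  assumes a: "inj (($) a)" and v: "\<And>j. v $ j \<noteq> 0" and k: "1 \<le> k" "k \<le> CARD('n)"
  shows "MDS_code k (grs a v k)"
proof -
  let ?C = "grs a v k"
  let ?D = "{hamming_dist x y |x y. x \<in> ?C \<and> y \<in> ?C \<and> x \<noteq> y}"
  have "?D \<subseteq> {..CARD('n)}" by (auto simp: hamming_dist_def intro: card_mono)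
  then have "finite ?D" by (rule finite_subset) simp
  moreover have "CARD('n) - k + 1 \<le> d" if "d \<in> ?D" for d
  proof -
    obtain x y where d: "d = hamming_dist x y" and xy: "x \<in> ?C" "y \<in> ?C" "x \<noteq> y"
      using \<open>d \<in> ?D\<close> by auto
    then have "x - y \<in> ?C" using vec.subspace_diff[OF subspace_grs] by blast
    then obtain f where f: "x - y = (\<chi> j. v $ j * poly f (a $ j))" "\<forall>i\<ge>k. coeff f i = 0"
      unfolding grs_def by auto
    have "f \<noteq> 0" using f(1) xy(3) by (auto simp: vec_eq_iff)
    have "{j. x $ j \<noteq> y $ j} = - {j. poly f (a $ j) = 0}"
    proof -
      have "x $ j - y $ j = v $ j * poly f (a $ j)" for j
        using f(1) by (simp add: vec_eq_iff)
      then have "x $ j = y $ j \<longleftrightarrow> poly f (a $ j) = 0" for j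
        using v[of j] by (metis eq_iff_diff_eq_0 mult_eq_0_iff)
      then show ?thesis by auto
    qed
    then have "d = CARD('n) - card {j. poly f (a $ j) = 0}"
      by (simp add: d hamming_dist_def Compl_eq_Diff_UNIV card_Diff_subset)
    moreover have "card {j. poly f (a $ j) = 0} < k"
      using card_zeros_le[OF a \<open>f \<noteq> 0\<close>] degree_less_if_coeff_0[OF f(2) \<open>f \<noteq> 0\<close>] by simp
    ultimately show ?thesis using k by linarith
  qed
  moreover have "CARD('n) - k + 1 \<in> ?D"
  proof -
    obtain J :: "'n set" where J: "card J = k - 1"
      using k by (meson diff_le_self le_trans obtain_subset_with_card_n)
    obtain f where f: "degree f = card J" "\<And>j. poly f (a $ j) = 0 \<longleftrightarrow> j \<in> J"
      using poly_vanishing_on[OF a] by blast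
    define x where "x = (\<chi> j. v $ j * poly f (a $ j))"
    have "\<forall>i\<ge>k. coeff f i = 0" using f(1) J k by (auto intro: coeff_eq_0)
    then have "x \<in> ?C" unfolding grs_def x_def by auto
    moreover have "{j. x $ j \<noteq> 0 $ j} = - J" using v f(2) by (auto simp: x_def)
    then have dist: "hamming_dist x 0 = CARD('n) - k + 1"
      using J k by (simp add: hamming_dist_def Compl_eq_Diff_UNIV card_Diff_subset)
    moreover have "x \<noteq> 0" using dist by (auto simp: hamming_dist_def)
    ultimately show ?thesis
      using vec.subspace_0[OF subspace_grs, of a v k]
      by (intro CollectI exI[of _ x] exI[of _ 0]) simp
  qed
  ultimately have "min_dist ?C = CARD('n) - k + 1"
    unfolding min_dist_def by (intro Min_eqI) auto
  then show ?thesis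
    unfolding MDS_code_def linear_code_def using subspace_grs dim_grs[OF a v k(2)] by blast
qed

lemma rescale_grs:
  "(\<lambda>x. \<chi> j. u j * x $ j) ` grs a v k = grs a (\<chi> j. u j * v $ j) k"
  unfolding grs_def by (force simp: mult.assoc)

text \<open>Any \<open>k\<close> coordinates form an information set of a GRS code.\<close>

lemma (in field_automorphism) radical_grs_indicator:
  fixes a v :: "'a ^ 'n::finite"
  assumes a: "inj (($) a)" and v: "\<And>j. v $ j \<noteq> 0" and J: "card J = k"
  shows "radical \<sigma> (\<lambda>j. if j \<in> J then 1 else 0) (grs a v k) \<subseteq> {0}"
proof
  fix x assume x: "x \<in> radical \<sigma> (\<lambda>j. if j \<in> J then 1 else 0) (grs a v k)"
  then obtain f where f: "x = (\<chi> j. v $ j * poly f (a $ j))" "\<forall>i\<ge>k. coeff f i = 0"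
    unfolding radical_def grs_def by auto
  have "x $ j = 0" if j: "j \<in> J" for j
  proof -
    \<comment> \<open>The weight removes the coordinates outside \<open>J\<close> and
      \<open>g\<close> removes those in \<open>J - {j}\<close>, so pairing with this codeword
      isolates \<open>x $ j\<close>.\<close>
    obtain g where g: "degree g = card (J - {j})" "\<And>i. poly g (a $ i) = 0 \<longleftrightarrow> i \<in> J - {j}"
      using poly_vanishing_on[OF a] by blast
    define y where "y = (\<chi> i. v $ i * poly g (a $ i))"
    have "card (J - {j}) < k" using J j by (metis card_Diff1_less finite)
    then have "\<forall>i\<ge>k. coeff g i = 0" using g(1) by (auto intro: coeff_eq_0)
    then have "y \<in> grs a v k" unfolding grs_def y_def by auto
    then have "0 = weighted_form \<sigma> (\<lambda>j. if j \<in> J then 1 else 0) y x"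
      using x by (simp add: radical_def)
    also have "\<dots> = (\<Sum>i\<in>UNIV. if i = j then y $ j * \<sigma> (x $ j) else 0)"
      unfolding weighted_form_def using j g(2) by (intro sum.cong) (auto simp: y_def)
    also have "\<dots> = y $ j * \<sigma> (x $ j)" by simp
    finally show "x $ j = 0" using v g(2) by (auto simp: y_def)
  qed
  then have zeros: "J \<subseteq> {j. poly f (a $ j) = 0}" using f(1) v by auto
  have "f = 0"
  proof (rule ccontr)
    assume "f \<noteq> 0"
    have "k \<le> card {j. poly f (a $ j) = 0}" using J zeros by (metis card_mono finite)
    with card_zeros_le[OF a \<open>f \<noteq> 0\<close>] degree_less_if_coeff_0[OF f(2) \<open>f \<noteq> 0\<close>]
    show False by simp
  qed
  then show "x \<in> {0}" using f(1) by (simp add: vec_eq_iff)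
qed

lemma (in field_automorphism) dim_radical_grs_add:
  fixes a v :: "'a ^ 'n::finite"
  shows "vec.dim (radical \<sigma> w (grs a v k)) \<le> vec.dim (radical \<sigma> w (grs a v (k + i))) + i"
proof (induction i)
  case (Suc i)
  have "vec.dim (radical \<sigma> w (grs a v (k + i))) \<le> vec.dim (radical \<sigma> w (grs a v (k + Suc i))) + 1"
    using dim_radical_extend[OF subspace_grs] by (simp add: grs_Suc)
  with Suc show ?case by simp
qed simp

section \<open>Finite fields\<close>

lemma field_automorphism_frobenius:
  fixes p m e :: nat
  assumes p: "prime p" and card: "CARD('a::{field,finite}) = p ^ m"
  shows "field_automorphism (\<lambda>x::'a. x ^ (p ^ e))"
proof
  \<comment> \<open>Translation by 1 permutes the field, so summing 1 over all elements gives 0.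
    Hence the characteristic divides a power of \<open>p\<close>, which forces it to be
    \<open>p\<close>.\<close>
  have "(\<Sum>x\<in>UNIV. x) = (\<Sum>x\<in>UNIV. x + 1 :: 'a)"
    by (rule sum.reindex_bij_witness[of _ "\<lambda>x. x + 1" "\<lambda>x. x - 1"]) auto
  then have "of_nat (p ^ m) = (0 :: 'a)" by (simp add: sum.distrib flip: card)
  then have "CHAR('a) dvd p" by (simp add: of_nat_eq_0_iff_char_dvd[symmetric])
  then have "CHAR('a) = p" using p CHAR_not_1'[where 'a = 'a] by (auto simp: prime_nat_iff)
  with p have char: "prime CHAR('a)" "CHAR('a) = p" by simp_all
  then show add: "(x + y) ^ (p ^ e) = x ^ (p ^ e) + y ^ (p ^ e)" for x y :: 'a
    using char by (intro freshmans_dream') auto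
  show "(x * y) ^ (p ^ e) = x ^ (p ^ e) * y ^ (p ^ e)" for x y :: 'a
    by (rule power_mult_distrib)
  have "inj (\<lambda>x::'a. x ^ (p ^ e))"
  proof (rule injI)
    fix x y :: 'a assume "x ^ (p ^ e) = y ^ (p ^ e)"
    then have "(x - y) ^ (p ^ e) = 0" using add[of "x - y" y] by simp
    then show "x = y" by simp
  qed
  then show "bij (\<lambda>x::'a. x ^ (p ^ e))" by (simp add: bij_def finite_UNIV_inj_surj)
qed

text \<open>Otherwise all nonzero field elements would be roots of a polynomial of degree
  \<open>d\<close>, which is smaller than their number.\<close>

lemma exists_power_neq_1:
  assumes "d + 1 < CARD('a::{field,finite})" and "0 < d"
  shows "\<exists>\<alpha>::'a. \<alpha> \<noteq> 0 \<and> \<alpha> ^ d \<noteq> 1"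
proof (rule ccontr)
  assume contr: "\<not> ?thesis"
  let ?f = "monom 1 d - 1 :: 'a poly"
  have "coeff ?f d = 1" using \<open>0 < d\<close> by simp
  then have f: "?f \<noteq> 0" by (metis coeff_0 zero_neq_one)
  have "CARD('a) - 1 = card (UNIV - {0::'a})" by simp
  also have "\<dots> \<le> card {x. poly ?f x = 0}"
    using contr by (intro card_mono) (auto simp: poly_monom)
  also have "\<dots> \<le> degree ?f" by (rule card_poly_roots_bound[OF f])
  also have "\<dots> \<le> d" by (intro degree_diff_le degree_monom_le) simp
  finally show False using assms by simp
qed

text \<open>Since \<open>p ^ e\<close> is at most half of \<open>p ^ m\<close>, the bound
  \<open>p ^ m > 4\<close> suffices. For \<open>p ^ m = 4\<close> and \<open>e = 1\<close> it fails,
  and there every nonzero element has cube 1.\<close>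

lemma prime_power_gap:
  fixes p m e :: nat
  assumes "prime p" and "p ^ m > 4" and "e \<le> m - 1"
  shows "p ^ e + 2 < p ^ m"
proof -
  have "p \<ge> 2" using assms(1) by (rule prime_ge_2_nat)
  \<comment> \<open>Truncated subtraction makes \<open>0 - 1 = 0\<close>, so \<open>m = 0\<close>
    must be excluded before \<open>e \<le> m - 1\<close> yields
    \<open>Suc e \<le> m\<close>.\<close>
  have "m \<noteq> 0" using assms(2) by (cases m) auto
  then have "p ^ Suc e \<le> p ^ m" using \<open>p \<ge> 2\<close> assms(3) by (intro power_increasing) auto
  moreover have "2 * p ^ e \<le> p ^ Suc e" using \<open>p \<ge> 2\<close> by simp
  ultimately show ?thesis using assms(2) by linarith
qed

section \<open>MDS codes with prescribed hull dimension\<close>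

theorem corollary5:
  fixes p m e n k l :: nat
  assumes "prime p"
    and "CARD('a::{field,finite}) = p ^ m"
    and "p ^ m > 4"
    and "e \<le> m - 1"
    and "CARD('n::finite) = n"
    and "l \<le> k"
    and "\<exists>C :: ('a ^ 'n) set. GRS_code k C \<and> vec.dim (galois_hull p e C) = l"
  shows "\<forall>i s. 1 \<le> i \<and> i \<le> min l (n - k) \<and> s \<le> l - i \<longrightarrow>
           (\<exists>C :: ('a ^ 'n) set. MDS_code (k + i) C \<and> vec.dim (galois_hull p e C) = s)"
proof (intro allI impI)
  fix i s assume i_s: "1 \<le> i \<and> i \<le> min l (n - k) \<and> s \<le> l - i"
  interpret field_automorphism "\<lambda>x::'a. x ^ (p ^ e)"
    using assms(1,2) by (rule field_automorphism_frobenius)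
  obtain a v :: "'a ^ 'n" where k: "1 \<le> k" "k \<le> n" and a: "inj (($) a)" and v: "\<And>j. v $ j \<noteq> 0"
    and l: "vec.dim (galois_hull p e (grs a v k)) = l"
    using assms(5,7) by (auto simp: GRS_code_iff_grs)
  have ki: "k + i \<le> CARD('n)" using i_s k assms(5) by linarith
  let ?C = "grs a v (k + i)"
  have "l \<le> vec.dim (radical (\<lambda>x. x ^ (p ^ e)) (\<lambda>_. 1) ?C) + i"
    using dim_radical_grs_add[of "\<lambda>_. 1" a v k i] l by (simp add: galois_hull_eq_radical)
  then have s: "s \<le> vec.dim (radical (\<lambda>x. x ^ (p ^ e)) (\<lambda>_. 1) ?C)" using i_s by linarith
  obtain \<alpha> :: 'a where \<alpha>: "\<alpha> \<noteq> 0" "\<alpha> ^ (p ^ e + 1) \<noteq> 1"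
    using exists_power_neq_1[where 'a = 'a, of "p ^ e + 1"] prime_power_gap[OF assms(1,3,4)] assms(2) by auto
  \<comment> \<open>As many coordinates as the dimension of \<open>?C\<close>: their indicator
    function is the nondegenerate starting weight.\<close>
  obtain J :: "'n set" where "card J = k + i"
    using ki by (meson obtain_subset_with_card_n)
  then obtain A where A: "vec.dim (radical (\<lambda>x. x ^ (p ^ e))
      (\<lambda>j. if j \<in> A then \<alpha> ^ (p ^ e + 1) else 1) ?C) = s"
    using radical_dim_two_weights[OF subspace_grs radical_grs_indicator[OF a v] \<alpha>(2)[symmetric] s]
    by blast
  \<comment> \<open>The powers of these scalars realise the weights found. Rescaling by them only
    changes the multipliers, so the code remains GRS and hence MDS.\<close>
  define u where "u j = (if j \<in> A then \<alpha> else 1)" for j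
  have u: "u j \<noteq> 0" for j using \<alpha>(1) by (simp add: u_def)
  have "u j ^ (p ^ e + 1) = (if j \<in> A then \<alpha> ^ (p ^ e + 1) else 1)" for j
    by (simp add: u_def)
  then have "vec.dim (galois_hull p e (grs a (\<chi> j. u j * v $ j) (k + i))) = s"
    using dim_galois_hull_rescale[of u p e ?C, OF u] A by (simp add: rescale_grs)
  moreover have "MDS_code (k + i) (grs a (\<chi> j. u j * v $ j) (k + i))"
    using u v k ki by (intro MDS_code_grs a) auto
  ultimately show "\<exists>C :: ('a ^ 'n) set. MDS_code (k + i) C \<and> vec.dim (galois_hull p e C) = s"
    by blast
qed

end
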